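(* There is no king Latin square of odd order.
   Context: A Latin square of order $n$ is an $n\times n$ table filled with the integers $1,\dots,n$ so that each integer appears exactly once in each row and in each column. A king Latin square is a Latin square such that for each cell there is another cell containing the same number that is a chess king's move apart, i.e. horizontally, vertically or diagonally adjacent (no wrap-around). *)

theory Defs
  imports Main
begin

text \<open>A square table of order \<open>n\<close> is a function \<open>L\<close> of a row and a column index, of which only
  the values at indices in \<open>{1..n}\<close> matter.\<close>

definition latin_square :: "nat \<Rightarrow> (nat \<Rightarrow> nat \<Rightarrow> nat) \<Rightarrow> bool" where
  "latin_square n L \<longleftrightarrow>
     (\<forall>i\<in>{1..n}. \<forall>j\<in>{1..n}. L i j \<in> {1..n}) \<and>
     (\<forall>i\<in>{1..n}. \<forall>k\<in>{1..n}. \<exists>!j. j \<in> {1..n} \<and> L i j = k) \<and>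
     (\<forall>j\<in>{1..n}. \<forall>k\<in>{1..n}. \<exists>!i. i \<in> {1..n} \<and> L i j = k)"

text \<open>The differences are taken in \<open>int\<close> because subtraction on \<open>nat\<close> truncates.\<close>

definition king_adjacent :: "nat \<times> nat \<Rightarrow> nat \<times> nat \<Rightarrow> bool" where
  "king_adjacent c d \<longleftrightarrow>
     c \<noteq> d \<and> \<bar>int (fst c) - int (fst d)\<bar> \<le> 1 \<and> \<bar>int (snd c) - int (snd d)\<bar> \<le> 1"

definition king_latin_square :: "nat \<Rightarrow> (nat \<Rightarrow> nat \<Rightarrow> nat) \<Rightarrow> bool" where
  "king_latin_square n L \<longleftrightarrow>
     latin_square n L \<and>
     (\<forall>i\<in>{1..n}. \<forall>j\<in>{1..n}. \<exists>i'\<in>{1..n}. \<exists>j'\<in>{1..n}.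
        king_adjacent (i, j) (i', j') \<and> L i' j' = L i j)"

end

theory Submission
  imports Defs
begin

text \<open>A cell of the first row shares its symbol with no other cell of its row or column, so its
  partner lies in the second row, one column to the left or right. Sending each column to that of
  the partner is thus a permutation of the columns which reverses parity everywhere, and such a
  permutation exists only if the number of columns is even.\<close>

text \<open>A permutation preserves the sum over \<open>A\<close>, so the terms
  \<open>a + p a\<close> add up to twice that sum. An even sum has an even number of odd terms, and
  here every term is odd.\<close>

lemma even_card_if_parity_reversing_permutation:
  fixes p :: "nat \<Rightarrow> nat"
  assumes fin: "finite A" and bij: "bij_betw p A A"
    and odd: "\<And>a. a \<in> A \<Longrightarrow> odd (a + p a)"
  shows "even (card A)"
proof -
  have "(\<Sum>a\<in>A. a + p a) = (\<Sum>a\<in>A. a) + (\<Sum>a\<in>A. a)"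
    using sum.reindex_bij_betw[OF bij, of "\<lambda>a. a"] by (simp add: sum.distrib)
  then have "even (\<Sum>a\<in>A. a + p a)"
    by simp
  moreover have "{a \<in> A. odd (a + p a)} = A"
    using odd by blast
  ultimately show ?thesis
    using even_sum_iff[OF fin, of "\<lambda>a. a + p a"] by simp
qed

lemma latin_square_row_inj:
  assumes "latin_square n L" "i \<in> {1..n}" "j \<in> {1..n}" "j' \<in> {1..n}" "L i j = L i j'"
  shows "j = j'"
proof -
  \<comment> \<open>The uniqueness clause speaks only of symbols in \<open>{1..n}\<close>, so
    \<open>L i j\<close> is first shown to be one.\<close>
  have "L i j \<in> {1..n}" "\<exists>!y. y \<in> {1..n} \<and> L i y = L i j"
    using assms(1-3) unfolding latin_square_def by blast+
  then show ?thesis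
    using assms(3-5) by auto
qed

lemma latin_square_column_inj:
  assumes "latin_square n L" "i \<in> {1..n}" "i' \<in> {1..n}" "j \<in> {1..n}" "L i j = L i' j"
  shows "i = i'"
proof -
  have "L i j \<in> {1..n}" "\<exists>!x. x \<in> {1..n} \<and> L x j = L i j"
    using assms(1,2,4) unfolding latin_square_def by blast+
  then show ?thesis
    using assms(2-5) by auto
qed

text \<open>The odd sum covers both neighbouring columns at once and is the form in which the parity
  argument counts.\<close>

lemma king_latin_square_first_row_partner:
  assumes king: "king_latin_square n L" and j: "j \<in> {1..n}"
  shows "\<exists>j'\<in>{1..n}. odd (j + j') \<and> L 2 j' = L 1 j"
proof -
  have latin: "latin_square n L"
    using king by (simp add: king_latin_square_def)
  have one: "1 \<in> {1..n}"
    using j by simp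
  have "\<exists>i'\<in>{1..n}. \<exists>j'\<in>{1..n}. king_adjacent (1, j) (i', j') \<and> L i' j' = L 1 j"
    using king one j by (simp only: king_latin_square_def)
  then obtain i' j' where i': "i' \<in> {1..n}" and j': "j' \<in> {1..n}"
    and adj: "king_adjacent (1, j) (i', j')" and eq: "L i' j' = L 1 j"
    by blast
  \<comment> \<open>A partner in row 1 would be the cell itself, which adjacency excludes.\<close>
  have "i' \<noteq> 1"
    using latin_square_row_inj[OF latin one j j'] adj eq by (auto simp: king_adjacent_def)
  moreover have "j' \<noteq> j"
    using latin_square_column_inj[OF latin i' one j'] eq \<open>i' \<noteq> 1\<close> by auto
  \<comment> \<open>There is no row 0 in the table, so row 2 is the only row left.\<close>
  ultimately have "i' = 2" "j' = Suc j \<or> j = Suc j'"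
    using adj i' by (auto simp: king_adjacent_def)
  then show ?thesis
    using j' eq by (intro bexI[of _ j']) auto
qed

theorem theorem19:
  fixes n :: nat
  assumes "odd n"
  shows "\<not> (\<exists>L. king_latin_square n L)"
proof
  assume "\<exists>L. king_latin_square n L"
  then obtain L where king: "king_latin_square n L"
    by blast
  then have latin: "latin_square n L"
    by (simp add: king_latin_square_def)
  have one: "1 \<in> {1..n}"
    using odd_pos[OF assms] by simp
  obtain p where p: "\<And>j. j \<in> {1..n} \<Longrightarrow> p j \<in> {1..n} \<and> odd (j + p j) \<and> L 2 (p j) = L 1 j"
    using bchoice[of "{1..n}" "\<lambda>j j'. j' \<in> {1..n} \<and> odd (j + j') \<and> L 2 j' = L 1 j"]
      king_latin_square_first_row_partner[OF king] by blast
  have "inj_on p {1..n}"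
  proof (rule inj_onI)
    fix j k
    assume j: "j \<in> {1..n}" and k: "k \<in> {1..n}" and eq: "p j = p k"
    \<comment> \<open>Both symbols equal the entry of row 2 in the common column
      \<open>p j = p k\<close>.\<close>
    have "L 1 j = L 1 k"
      using p[OF j] p[OF k] eq by simp
    then show "j = k"
      by (rule latin_square_row_inj[OF latin one j k])
  qed
  moreover have "p ` {1..n} \<subseteq> {1..n}"
    using p by blast
  \<comment> \<open>An injection of a finite set into itself is onto.\<close>
  ultimately have "bij_betw p {1..n} {1..n}"
    by (simp add: bij_betw_def endo_inj_surj)
  then have "even (card {1..n})"
    using p even_card_if_parity_reversing_permutation[OF finite_atLeastAtMost] by blast
  then show False
    using assms by simp
qed

end
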